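(* Let $\Gamma\le S_m$ act transitively on $[m]$ and let $a_1,\dots,a_m\ge2$ be integers. Then \[R_\Gamma(a_1,a_2,\dots,a_m)\le R(a_1-1,a_2-1,\dots,a_m-1)+1.\]
   Context: An $m$-edge-coloured complete graph is a complete graph with each edge coloured from $[m]=\{1,\dots,m\}$. For $\Gamma\le S_m$, $\pi\in\Gamma$ and a vertex $v$, switching at $v$ with $\pi$ recolours every edge incident with $v$ of colour $i$ to colour $\pi(i)$, leaving other edges unchanged. Two such graphs on the same vertex set are $\Gamma$-switch equivalent if one is obtained from the other by a finite sequence of switches. $K_t^{(i)}$ is a complete graph on $t$ vertices with all edges of colour $i$. $R_\Gamma(a_1,\dots,a_m)$ is the least $n$ such that every $m$-edge-coloured complete graph on $n$ vertices is $\Gamma$-switch equivalent to one containing, for some $i$, a copy of $K_{a_i}^{(i)}$. $R(b_1,\dots,b_m)$ is the classical Ramsey number: the least $n$ such that every $m$-edge-colouring of $K_n$ contains, for some $i$, a $K_{b_i}$ with all edges of colour $i$ (so it equals $1$ if some $b_i=1$). *)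

theory Defs
  imports "HOL-Library.Ramsey" "HOL-Library.FuncSet" "HOL-Algebra.Sym_Groups"
begin

text \<open>The edges of the complete graph on \<open>V\<close> are the two-element sets in \<open>nsets V 2\<close>.
  Colourings are extensional, so that equality of functions is equality of coloured graphs.\<close>

definition coloured_complete_graphs :: "'a set \<Rightarrow> nat \<Rightarrow> ('a set \<Rightarrow> nat) set" where
  "coloured_complete_graphs V m = nsets V 2 \<rightarrow>\<^sub>E {1..m}"

definition switch :: "'a set \<Rightarrow> 'a \<Rightarrow> (nat \<Rightarrow> nat) \<Rightarrow> ('a set \<Rightarrow> nat) \<Rightarrow> ('a set \<Rightarrow> nat)" where
  "switch V v \<pi> c = (\<lambda>e\<in>nsets V 2. if v \<in> e then \<pi> (c e) else c e)"

definition switch_step ::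
  "(nat \<Rightarrow> nat) set \<Rightarrow> 'a set \<Rightarrow> ('a set \<Rightarrow> nat) \<Rightarrow> ('a set \<Rightarrow> nat) \<Rightarrow> bool" where
  "switch_step \<Gamma> V c d \<longleftrightarrow> (\<exists>v\<in>V. \<exists>\<pi>\<in>\<Gamma>. d = switch V v \<pi> c)"

definition switch_equivalent ::
  "(nat \<Rightarrow> nat) set \<Rightarrow> 'a set \<Rightarrow> ('a set \<Rightarrow> nat) \<Rightarrow> ('a set \<Rightarrow> nat) \<Rightarrow> bool" where
  "switch_equivalent \<Gamma> V = (switch_step \<Gamma> V)\<^sup>*\<^sup>*"

definition contains_mono :: "'a set \<Rightarrow> ('a set \<Rightarrow> nat) \<Rightarrow> nat \<Rightarrow> nat \<Rightarrow> bool" where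
  "contains_mono V c t i \<longleftrightarrow> (\<exists>H\<in>nsets V t. \<forall>e\<in>nsets H 2. c e = i)"

definition switch_arrows :: "(nat \<Rightarrow> nat) set \<Rightarrow> nat \<Rightarrow> (nat \<Rightarrow> nat) \<Rightarrow> nat \<Rightarrow> bool" where
  "switch_arrows \<Gamma> m a n \<longleftrightarrow>
    (\<forall>c\<in>coloured_complete_graphs {..<n} m.
       \<exists>d. switch_equivalent \<Gamma> {..<n} c d \<and> (\<exists>i\<in>{1..m}. contains_mono {..<n} d (a i) i))"

definition switch_ramsey_number :: "(nat \<Rightarrow> nat) set \<Rightarrow> nat \<Rightarrow> (nat \<Rightarrow> nat) \<Rightarrow> nat" where
  "switch_ramsey_number \<Gamma> m a = (LEAST n. switch_arrows \<Gamma> m a n)"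

text \<open>\<open>partn_lst\<close> numbers the colours from 0, so its colour \<open>i\<close>
  belongs to \<open>b (Suc i)\<close>.\<close>

definition ramsey_number :: "nat \<Rightarrow> (nat \<Rightarrow> nat) \<Rightarrow> nat" where
  "ramsey_number m b = (LEAST n. partn_lst {..<n} (map b [1..<Suc m]) 2)"

text \<open>Both minima are attained, whence neither \<open>LEAST\<close> is vacuous.\<close>

lemma partn_lst_ramsey_number:
  "partn_lst {..<ramsey_number m b} (map b [1..<Suc m]) 2"
  unfolding ramsey_number_def
  by (rule LeastI_ex) (use ramsey_full in blast)

lemma partn_lst_imp_switch_arrows:
  assumes P: "partn_lst {..<n} (map a [1..<Suc m]) 2"
  shows "switch_arrows \<Gamma> m a n"
  unfolding switch_arrows_def
proof
  fix c assume c: "c \<in> coloured_complete_graphs {..<n} m"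
  have "(\<lambda>e. c e - 1) \<in> nsets {..<n} 2 \<rightarrow> {..<length (map a [1..<Suc m])}"
  proof
    fix e assume "e \<in> nsets {..<n} 2"
    then have "c e \<in> {1..m}"
      using c by (auto simp: coloured_complete_graphs_def)
    then show "c e - 1 \<in> {..<length (map a [1..<Suc m])}"
      by auto
  qed
  then obtain i H where i: "i < length (map a [1..<Suc m])"
    and H: "H \<in> nsets {..<n} (map a [1..<Suc m] ! i)"
    and mono: "(\<lambda>e. c e - 1) ` nsets H 2 \<subseteq> {i}"
    using P unfolding partn_lst_def monochromatic_def by blast
  have im: "i < m" using i by (simp del: upt_Suc)
  then have Ha: "H \<in> nsets {..<n} (a (Suc i))"
    using H by (simp del: upt_Suc)
  have "c e = Suc i" if e: "e \<in> nsets H 2" for e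
  proof -
    have "H \<subseteq> {..<n}" using Ha by (simp add: nsets_def)
    then have "e \<in> nsets {..<n} 2" using e nsets_mono by blast
    then have "c e \<in> {1..m}"
      using c by (auto simp: coloured_complete_graphs_def)
    moreover have "c e - 1 = i" using mono e by blast
    ultimately show ?thesis by auto
  qed
  then have "contains_mono {..<n} c (a (Suc i)) (Suc i)"
    using Ha unfolding contains_mono_def by blast
  moreover have "Suc i \<in> {1..m}" using im by simp
  moreover have "switch_equivalent \<Gamma> {..<n} c c"
    by (simp add: switch_equivalent_def)
  ultimately show "\<exists>d. switch_equivalent \<Gamma> {..<n} c d
      \<and> (\<exists>i\<in>{1..m}. contains_mono {..<n} d (a i) i)"
    by blast
qed

lemma switch_arrows_switch_ramsey_number:
  "switch_arrows \<Gamma> m a (switch_ramsey_number \<Gamma> m a)"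
  unfolding switch_ramsey_number_def
  by (rule LeastI) (rule partn_lst_imp_switch_arrows[OF partn_lst_ramsey_number])

end

(* Fix a vertex w of a graph on R + 1 vertices.  Since edges between w and the other vertices
   meet exactly one of those, switching at each other vertex in turn makes all edges at w have
   one colour k.  The remaining R vertices contain a monochromatic complete graph on a i - 1
   vertices, of colour i say.  A switch at w taking k to i does not affect it and lets w extend
   it to a i vertices. *)

theory Submission
  imports Defs
begin

lemma switch_apply:
  assumes "e \<in> nsets V 2"
  shows "switch V v \<pi> c e = (if v \<in> e then \<pi> (c e) else c e)"
  using assms by (simp add: switch_def)

lemma switch_in_coloured_complete_graphs:
  assumes "\<pi> permutes {1..m}" and c: "c \<in> coloured_complete_graphs V m"
  shows "switch V v \<pi> c \<in> coloured_complete_graphs V m"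
proof -
  have "(if v \<in> e then \<pi> (c e) else c e) \<in> {1..m}" if "e \<in> nsets V 2" for e
    using PiE_mem[OF c[unfolded coloured_complete_graphs_def] that]
      permutes_in_image[OF assms(1)] by simp
  then show ?thesis
    unfolding coloured_complete_graphs_def switch_def by (rule restrict_PiE_iff[THEN iffD2, OF ballI])
qed

lemma switch_equivalent_switch:
  assumes "switch_equivalent \<Gamma> V c d" "v \<in> V" "\<pi> \<in> \<Gamma>"
  shows "switch_equivalent \<Gamma> V c (switch V v \<pi> d)"
proof -
  have "switch_step \<Gamma> V d (switch V v \<pi> d)"
    using assms(2,3) by (auto simp: switch_step_def)
  with assms(1) show ?thesis
    unfolding switch_equivalent_def by (rule rtranclp.rtrancl_into_rtrancl[where r = "switch_step \<Gamma> V"])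
qed

text \<open>Induction on \<open>S\<close>. As \<open>S\<close> omits \<open>w\<close>, the switch at
  the new vertex \<open>x\<close> meets only one of the edges from \<open>w\<close> to
  \<open>insert x S\<close>, namely \<open>{x, w}\<close>, so the edges already of colour
  \<open>k\<close> keep it. Membership in \<open>coloured_complete_graphs\<close> is carried along
  because \<open>trans\<close> speaks only of colours in \<open>{1..m}\<close>.\<close>

lemma switch_equivalent_star_monochromatic:
  assumes perm: "\<And>\<pi>. \<pi> \<in> \<Gamma> \<Longrightarrow> \<pi> permutes {1..m}"
    and trans: "\<And>j. j \<in> {1..m} \<Longrightarrow> \<exists>\<pi>\<in>\<Gamma>. \<pi> j = k"
    and c: "c \<in> coloured_complete_graphs V m"
    and "w \<in> V" "finite S" "S \<subseteq> V - {w}"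
  shows "\<exists>d \<in> coloured_complete_graphs V m.
           switch_equivalent \<Gamma> V c d \<and> (\<forall>v\<in>S. d {v, w} = k)"
  using \<open>finite S\<close> \<open>S \<subseteq> V - {w}\<close>
proof (induction S)
  case empty
  then show ?case
    using c by (auto simp: switch_equivalent_def)
next
  case (insert x S)
  then obtain d where d: "d \<in> coloured_complete_graphs V m" "switch_equivalent \<Gamma> V c d"
    and S: "\<forall>v\<in>S. d {v, w} = k"
    by auto
  have edge: "{v, w} \<in> nsets V 2" if "v \<in> insert x S" for v
    using that insert.prems \<open>w \<in> V\<close> by auto
  then have "d {x, w} \<in> {1..m}"
    using PiE_mem[OF d(1)[unfolded coloured_complete_graphs_def]] by blast
  then obtain \<pi> where \<pi>: "\<pi> \<in> \<Gamma>" "\<pi> (d {x, w}) = k"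
    using trans by blast
  have "switch V x \<pi> d {v, w} = k" if "v \<in> insert x S" for v
  proof (cases "v = x")
    case True
    then show ?thesis
      using switch_apply[OF edge[OF that]] \<pi>(2) by simp
  next
    case False
    then have "x \<notin> {v, w}" "v \<in> S"
      using that insert.prems by blast+
    then show ?thesis
      using switch_apply[OF edge[OF that]] S by simp
  qed
  moreover have "switch V x \<pi> d \<in> coloured_complete_graphs V m"
    by (rule switch_in_coloured_complete_graphs[OF perm[OF \<pi>(1)] d(1)])
  moreover have "switch_equivalent \<Gamma> V c (switch V x \<pi> d)"
    using switch_equivalent_switch[OF d(2) _ \<pi>(1)] insert.prems by simp
  ultimately show ?case
    by blast
qed

text \<open>Passes from colours counted from 0 to colours counted from 1. Only the values of
  \<open>c\<close> on \<open>nsets V 2\<close> are constrained, so a colouring of a larger complete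
  graph can be used on \<open>V\<close> as it is.\<close>

lemma partn_lst_imp_contains_mono:
  assumes P: "partn_lst V (map b [1..<Suc m]) 2"
    and c: "\<And>e. e \<in> nsets V 2 \<Longrightarrow> c e \<in> {1..m}"
  shows "\<exists>i\<in>{1..m}. contains_mono V c (b i) i"
proof -
  have "(\<lambda>e. c e - 1) \<in> nsets V 2 \<rightarrow> {..<length (map b [1..<Suc m])}"
    using c by (fastforce simp del: upt_Suc)
  then obtain i H where i: "i < m" and H: "H \<in> nsets V (b (Suc i))"
    and mono: "(\<lambda>e. c e - 1) ` nsets H 2 \<subseteq> {i}"
    using P unfolding partn_lst_def monochromatic_def by (auto simp del: upt_Suc)
  have "c e = Suc i" if e: "e \<in> nsets H 2" for e
  proof -
    have "e \<in> nsets V 2"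
      using H e nsets_mono by (auto simp: nsets_def)
    \<comment> \<open>Positivity is what turns \<open>c e - 1 = i\<close> into
      \<open>c e = Suc i\<close>: under truncated subtraction the value 0 would also give
      \<open>i = 0\<close>.\<close>
    then have "c e \<in> {1..m}"
      by (rule c)
    moreover have "c e - 1 = i"
      using mono e by blast
    ultimately show ?thesis
      by auto
  qed
  then show ?thesis
    using H i unfolding contains_mono_def by (intro bexI[of _ "Suc i"]) auto
qed

text \<open>An edge inside the clique \<open>H\<close> avoids \<open>w\<close> and keeps its colour
  \<open>i\<close>; an edge from \<open>w\<close> to \<open>H\<close> has colour \<open>k\<close>,
  which the switch turns into \<open>i\<close>.\<close>

lemma contains_mono_insert_switch:
  assumes H: "contains_mono V c t i"
    and w: "w \<notin> V" and star: "\<And>v. v \<in> V \<Longrightarrow> c {v, w} = k" and "\<pi> k = i"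
  shows "contains_mono (insert w V) (switch (insert w V) w \<pi> c) (Suc t) i"
proof -
  obtain H where H: "H \<subseteq> V" "finite H" "card H = t" "\<And>e. e \<in> nsets H 2 \<Longrightarrow> c e = i"
    using H by (auto simp: contains_mono_def nsets_def)
  have "switch (insert w V) w \<pi> c e = i" if e: "e \<in> nsets (insert w H) 2" for e
  proof -
    have eV: "e \<in> nsets (insert w V) 2"
      using e H(1) by (auto simp: nsets_def)
    show ?thesis
    proof (cases "w \<in> e")
      case True
      then obtain v where v: "e = {v, w}" "v \<in> H"
        using e by (auto simp: nsets_def card_2_iff)
      then have "c e = k"
        using star H(1) by blast
      then show ?thesis
        using switch_apply[OF eV] True \<open>\<pi> k = i\<close> by simp
    next
      case False
      then have "e \<in> nsets H 2"
        using e by (auto simp: nsets_def)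
      then show ?thesis
        using switch_apply[OF eV] False H(4) by simp
    qed
  qed
  moreover have "insert w H \<in> nsets (insert w V) (Suc t)"
    using H w by (auto simp: nsets_def card_insert_if)
  ultimately show ?thesis
    unfolding contains_mono_def by blast
qed

theorem theorem13:
  fixes m :: nat and \<Gamma> :: "(nat \<Rightarrow> nat) set" and a :: "nat \<Rightarrow> nat"
  assumes "subgroup \<Gamma> (sym_group m)"
    and "\<forall>i\<in>{1..m}. \<forall>j\<in>{1..m}. \<exists>\<pi>\<in>\<Gamma>. \<pi> i = j"
    and "\<forall>i\<in>{1..m}. a i \<ge> 2"
  shows "switch_ramsey_number \<Gamma> m a \<le> ramsey_number m (\<lambda>i. a i - 1) + 1"
proof -
  define R where "R = ramsey_number m (\<lambda>i. a i - 1)"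
  have P: "partn_lst {..<R} (map (\<lambda>i. a i - 1) [1..<Suc m]) 2"
    unfolding R_def by (rule partn_lst_ramsey_number)
  have perm: "\<pi> permutes {1..m}" if "\<pi> \<in> \<Gamma>" for \<pi>
    using that subgroup.subset[OF assms(1)] by (auto simp: sym_group_def)
  have "switch_arrows \<Gamma> m a (Suc R)"
    unfolding switch_arrows_def
  proof
    fix c assume c: "c \<in> coloured_complete_graphs {..<Suc R} m"
    have sub: "nsets {..<R} 2 \<subseteq> nsets {..<Suc R} 2"
      by (rule nsets_mono) auto
    have c_range: "d e \<in> {1..m}"
      if "d \<in> coloured_complete_graphs {..<Suc R} m" "e \<in> nsets {..<R} 2" for d e
      using PiE_mem[OF that(1)[unfolded coloured_complete_graphs_def]] that(2) sub by blast
    (* The case m = 0 is excluded here, because then c forces R = 0, contradicting P. *)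
    have "\<exists>k. k \<in> {1..m}"
      using partn_lst_imp_contains_mono[OF P, of c] c_range[OF c] by blast
    then obtain k where k: "k \<in> {1..m}" ..
    \<comment> \<open>The last vertex \<open>R\<close> plays the role of \<open>w\<close>; the
      colour \<open>k\<close> is arbitrary.\<close>
    have "\<exists>d\<in>coloured_complete_graphs {..<Suc R} m.
        switch_equivalent \<Gamma> {..<Suc R} c d \<and> (\<forall>v\<in>{..<R}. d {v, R} = k)"
    proof (rule switch_equivalent_star_monochromatic[OF perm _ c])
      show "\<exists>\<pi>\<in>\<Gamma>. \<pi> j = k" if "j \<in> {1..m}" for j
        using assms(2) k that by blast
    qed auto
    then obtain d where d: "d \<in> coloured_complete_graphs {..<Suc R} m"
        "switch_equivalent \<Gamma> {..<Suc R} c d"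
      and star: "\<forall>v\<in>{..<R}. d {v, R} = k"
      by blast
    \<comment> \<open>The Ramsey property is applied to \<open>d\<close> rather than
      \<open>c\<close>, since the switches at the vertices below \<open>R\<close> also recolour
      edges among them.\<close>
    obtain i where i: "i \<in> {1..m}" and mono: "contains_mono {..<R} d (a i - 1) i"
      using partn_lst_imp_contains_mono[OF P, of d] c_range[OF d(1)] by blast
    \<comment> \<open>Only now is the target colour \<open>i\<close> known; transitivity moves the
      whole star at \<open>R\<close> from \<open>k\<close> to it by a single switch.\<close>
    obtain \<pi> where \<pi>: "\<pi> \<in> \<Gamma>" "\<pi> k = i"
      using assms(2) k i by blast
    \<comment> \<open>The lower bound on \<open>a i\<close> rules out truncation in
      \<open>a i - 1\<close>.\<close>
    have "Suc (a i - 1) = a i"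
      using bspec[OF assms(3) i] by simp
    moreover have "contains_mono (insert R {..<R}) (switch (insert R {..<R}) R \<pi> d) (Suc (a i - 1)) i"
      by (rule contains_mono_insert_switch[OF mono, of R k \<pi>]) (use star \<pi>(2) in auto)
    ultimately have "contains_mono {..<Suc R} (switch {..<Suc R} R \<pi> d) (a i) i"
      by (simp only: lessThan_Suc)
    moreover have "switch_equivalent \<Gamma> {..<Suc R} c (switch {..<Suc R} R \<pi> d)"
      using switch_equivalent_switch[OF d(2) _ \<pi>(1)] by simp
    ultimately show "\<exists>d. switch_equivalent \<Gamma> {..<Suc R} c d
        \<and> (\<exists>i\<in>{1..m}. contains_mono {..<Suc R} d (a i) i)"
      using i by blast
  qed
  then show ?thesis
    unfolding switch_ramsey_number_def R_def by (simp add: Least_le)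
qed

end
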